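(* Suppose that $\pi(\theta)=\tfrac12\theta\cdot A^{-1}\cdot\theta$ for $\theta\in\mathbb R^k$, where $A$ is positive definite, let $\Lambda=\mathbb R^+\cup\{\infty\}$, and let $\Sigma$ be a positive definite $k\times k$ matrix. With $SURE$ as defined in the context, the following holds: 1. For every point $\theta$, $\sup_{\lambda\in\Lambda}|SURE(\lambda,\theta')-SURE(\lambda,\theta)|\to0$ as $\theta'\to\theta$. 2. The function $SURE(\lambda,R,\nu)$ is strictly supermodular in $\lambda$ and $R$. This implies: (a) $\lambda(R,\nu)=\arg\min_{\lambda\in\mathbb R^+}SURE(\lambda,R,\nu)$ is monotonically decreasing in $R$, given $\nu$. (b) $\lambda(R,\nu)$ has at most countably many discontinuities, as a function of $R$, given $\nu$. 3. Fix $\nu$ and $R$ such that $\lambda(\cdot)$ is continuous in $R$ at $(R,\nu)$, and let $\bar\lambda=\lambda(R,\nu)$. Then the minimum of $SURE$ is well separated: for any $\epsilon>0$, $$\inf_{\lambda\in\mathbb R^+\setminus[\bar\lambda-\epsilon,\bar\lambda+\epsilon]}SURE(\lambda,R,\nu)-SURE(\bar\lambda,R,\nu)>0 .$$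
   Context: $\mathbb R^+=[0,\infty)$. $\|\cdot\|$ is the Euclidean norm. $g^\lambda(\theta)=\arg\min_g[\tfrac12\|g\|^2+\lambda\pi(\theta+g)]$, and $SURE(\lambda,\theta)=SURE(\lambda,\theta,\Sigma)=\tfrac12[\operatorname{trace}(\Sigma)+\|g^\lambda(\theta)\|^2+2\operatorname{trace}(\nabla g^\lambda(\theta)\cdot\Sigma)]$, where $\nabla g^\lambda$ is the derivative in $\theta$. For the penalty considered here, $g^\lambda(\theta)=C_\lambda\theta$ and $\nabla g^\lambda(\theta)=C_\lambda$ with $C_\lambda=-(\tfrac1\lambda A+I)^{-1}$ ($C_0=0$, $C_\infty=-I$), so $SURE(\lambda,\theta)=\tfrac12[\operatorname{trace}(\Sigma)+\|C_\lambda\theta\|^2+2\operatorname{trace}(C_\lambda\Sigma)]$. Polar coordinates: for $\theta\neq0$ write $R=\|\theta\|>0$ and $\nu=\theta/R$ (a unit vector), and $SURE(\lambda,R,\nu)=SURE(\lambda,R\nu)$. Strict supermodularity in $(\lambda,R)$ means that for all $\epsilon,\delta>0$, $[SURE(\lambda+\epsilon,R,\nu)-SURE(\lambda,R,\nu)]-[SURE(\lambda+\epsilon,R-\delta,\nu)-SURE(\lambda,R-\delta,\nu)]>0$. If the minimizer over $\lambda$ is not unique, the smallest is taken. *)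

theory Defs
  imports "HOL-Analysis.Analysis"
begin

text \<open>Positive definite matrices are symmetric by convention.\<close>

definition pos_def :: "real ^ 'k ^ 'k \<Rightarrow> bool" where
  "pos_def M \<longleftrightarrow> transpose M = M \<and> (\<forall>x. x \<noteq> 0 \<longrightarrow> 0 < x \<bullet> (M *v x))"

text \<open>
  The parameter set $[0,\infty) \cup \{\infty\}$. For the objective at \<open>l = \<infinity>\<close> note that
  \<open>\<infinity> * 0 = 0\<close> in \<^typ>\<open>ereal\<close>, so the penalty becomes the hard constraint
  \<open>\<pi> (\<theta> + g) = 0\<close> (for a nonnegative penalty). If \<open>\<pi>\<close> vanishes only at \<open>0\<close>, this forces
  \<open>g = - \<theta>\<close>, the limit of the finite case.
\<close>

definition Lam :: "ereal set" where
  "Lam = {l. 0 \<le> l}"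

definition pen_step :: "(real ^ 'k \<Rightarrow> real) \<Rightarrow> ereal \<Rightarrow> real ^ 'k \<Rightarrow> real ^ 'k" where
  "pen_step \<pi> l \<theta> =
     (ARG_MIN (\<lambda>g. ereal (1/2 * (norm g)\<^sup>2) + l * ereal (\<pi> (\<theta> + g))) g. True)"

definition SURE ::
  "(real ^ 'k \<Rightarrow> real) \<Rightarrow> real ^ 'k ^ 'k \<Rightarrow> ereal \<Rightarrow> real ^ 'k \<Rightarrow> real" where
  "SURE \<pi> \<Sigma> l \<theta> =
     1/2 * (trace \<Sigma> + (norm (pen_step \<pi> l \<theta>))\<^sup>2
            + 2 * trace (jacobian (pen_step \<pi> l) (at \<theta>) ** \<Sigma>))"

definition SURE_polar ::
  "(real ^ 'k \<Rightarrow> real) \<Rightarrow> real ^ 'k ^ 'k \<Rightarrow> ereal \<Rightarrow> real \<Rightarrow> real ^ 'k \<Rightarrow> real" where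
  "SURE_polar \<pi> \<Sigma> l R \<nu> = SURE \<pi> \<Sigma> l (R *\<^sub>R \<nu>)"

text \<open>
  The increment \<open>\<epsilon>\<close> may be \<open>\<infinity>\<close>, so that the upper parameter \<open>l + \<epsilon>\<close> ranges over all
  elements of \<^const>\<open>Lam\<close> above \<open>l\<close>; the lower one has to be finite for \<open>l < l + \<epsilon>\<close>.
  The condition \<open>\<delta> < R\<close> keeps both radii positive.
\<close>

definition strictly_supermodular :: "(ereal \<Rightarrow> real \<Rightarrow> real) \<Rightarrow> bool" where
  "strictly_supermodular f \<longleftrightarrow>
     (\<forall>(l::real) (\<epsilon>::ereal) R \<delta>. 0 \<le> l \<and> 0 < \<epsilon> \<and> 0 < \<delta> \<and> \<delta> < R \<longrightarrow>
        (f (ereal l + \<epsilon>) R - f (ereal l) R)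
          - (f (ereal l + \<epsilon>) (R - \<delta>) - f (ereal l) (R - \<delta>)) > 0)"

text \<open>
  The smallest minimizer over $[0,\infty)$. A minimizer need not exist there: for \<open>k = 1\<close> and
  \<open>R\<^sup>2 \<le> \<Sigma>\<close> the infimum is only approached as \<open>l \<rightarrow> \<infinity>\<close>. In that case the
  value is \<open>\<infinity>\<close>, which for quadratic \<open>\<pi>\<close> is the minimizer over \<^const>\<open>Lam\<close>.
\<close>

definition lam_opt ::
  "(real ^ 'k \<Rightarrow> real) \<Rightarrow> real ^ 'k ^ 'k \<Rightarrow> real \<Rightarrow> real ^ 'k \<Rightarrow> ereal" where
  "lam_opt \<pi> \<Sigma> R \<nu> =
     (let is_min = is_arg_min (\<lambda>l::real. SURE_polar \<pi> \<Sigma> (ereal l) R \<nu>) (\<lambda>l. 0 \<le> l)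
      in if \<exists>l. is_min l then ereal (LEAST l. is_min l) else \<infinity>)"

end

theory Submission
  imports Defs
begin

text \<open>
  The step \<open>g\<close> is characterised by the first-order condition \<open>g = - \<lambda> B (\<theta> + g)\<close> with
  \<open>B = A\<inverse>\<close>. It makes the minimizer linear in \<open>\<theta>\<close> and continuous in \<open>\<lambda> \<in> [0, \<infinity>]\<close>; no
  spectral decomposition is needed. Comparing optimality of two penalties shows that
  \<open>\<parallel>g\<parallel>\<close> is strictly increasing in \<open>\<lambda>\<close>, and \<open>SURE\<close> depends on \<open>R\<close> only through
  \<open>R\<^sup>2 \<parallel>C\<^sub>\<lambda> \<nu>\<parallel>\<^sup>2\<close>, which gives supermodularity. Since \<open>\<parallel>g\<parallel> \<le> \<parallel>\<theta>\<parallel>\<close> for all \<open>\<lambda>\<close>,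
  the convergence in \<open>\<theta>\<close> is uniform.

  On the compact interval \<open>[0, \<infinity>]\<close> a least minimizer always exists. It is \<open>\<infinity>\<close> exactly when
  no minimizer over \<open>[0, \<infinity>)\<close> exists, because a finite minimizer is by continuity at least as
  good as \<open>\<infinity>\<close>. If the minimum at \<open>R\<close> were not well separated, compactness would give a second
  minimizer \<open>c > \<lambda>(R, \<nu>)\<close>, possibly \<open>\<infinity>\<close>. By supermodularity \<open>\<lambda>(r, \<nu>) \<ge> c\<close> for all
  \<open>r < R\<close>, so \<open>\<lambda>(\<cdot>, \<nu>)\<close> would jump at \<open>R\<close>.
\<close>

section \<open>Monotone comparative statics\<close>

text \<open>Countability is available for monotone real functions, so \<open>h\<close> is negated
  and sent into the reals by the strictly increasing \<open>\<phi>\<close>. The values 2 and -2 lie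
  beyond the range of \<open>arctan\<close>, because pi/2 < 2.\<close>

lemma antimono_on_ereal_countable_discont_open:
  fixes h :: "real \<Rightarrow> ereal"
  assumes "open S" and anti: "antimono_on S h"
  shows "countable {x \<in> S. \<not> isCont h x}"
proof -
  define \<phi> :: "ereal \<Rightarrow> real" where
    "\<phi> l = (if l = \<infinity> then 2 else if l = -\<infinity> then -2 else arctan (real_of_ereal l))" for l
  have bds: "arctan x < 2" "-2 < arctan x" for x
    using arctan_bounded[of x] pi_half_less_two by linarith+
  have strict: "\<phi> a < \<phi> b" if "a < b" for a b
    using that bds by (cases a; cases b) (auto simp: \<phi>_def arctan_less_iff)
  have refl: "a < b" if "\<phi> a < \<phi> b" for a b
    using that strict[of b a] by (cases a b rule: linorder_cases) auto
  have "mono_on S (\<lambda>x. - \<phi> (h x))"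
  proof (rule mono_onI)
    fix x y assume "x \<in> S" "y \<in> S" "x \<le> y"
    then have "h y \<le> h x" using anti by (auto simp: monotone_on_def)
    then show "- \<phi> (h x) \<le> - \<phi> (h y)" using strict[of "h y" "h x"] by (cases "h y = h x") (auto simp: less_le)
  qed
  then have "countable {x \<in> S. \<not> isCont (\<lambda>x. - \<phi> (h x)) x}"
    using \<open>open S\<close> by (rule mono_on_ctble_discont_open[rotated])
  moreover have "isCont h x" if "isCont (\<lambda>x. - \<phi> (h x)) x" for x
  proof -
    have lim: "((\<lambda>x. \<phi> (h x)) \<longlongrightarrow> \<phi> (h x)) (at x)"
      using tendsto_minus[OF that[unfolded isCont_def]] by simp
    \<comment> \<open>Continuity is pulled back through \<open>\<phi>\<close> by strict monotonicity alone; \<open>\<phi>\<close> jumps at \<open>\<plusminus>\<infinity>\<close>.\<close>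
    show ?thesis unfolding isCont_def
    proof (rule order_tendstoI)
      fix a assume "a < h x"
      from order_tendstoD(1)[OF lim strict[OF this]]
      show "\<forall>\<^sub>F y in at x. a < h y" by (rule eventually_mono) (rule refl)
    next
      fix a assume "h x < a"
      from order_tendstoD(2)[OF lim strict[OF this]]
      show "\<forall>\<^sub>F y in at x. h y < a" by (rule eventually_mono) (rule refl)
    qed
  qed
  ultimately show ?thesis by (elim countable_subset[rotated]) auto
qed

text \<open>Infinity is among the competitors. The strict last clause makes \<open>m\<close> the
  smallest minimizer without a choice operator.\<close>

definition least_minimizer :: "(ereal \<Rightarrow> real) \<Rightarrow> ereal \<Rightarrow> bool" where
  "least_minimizer f m \<longleftrightarrow> 0 \<le> m \<and> (\<forall>l\<ge>0. f m \<le> f l) \<and> (\<forall>l. 0 \<le> l \<and> l < m \<longrightarrow> f m < f l)"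

lemma le_at_infinity:
  fixes f :: "ereal \<Rightarrow> real"
  assumes cont: "continuous_on {0..} f" and le: "\<And>l::real. 0 \<le> l \<Longrightarrow> c \<le> f (ereal l)"
  shows "c \<le> f \<infinity>"
proof -
  have "(\<lambda>n. f (ereal (real n))) \<longlonglongrightarrow> f \<infinity>"
    by (rule continuous_on_tendsto_compose[OF cont id_nat_ereal_tendsto_PInf]) auto
  then show ?thesis by (rule LIMSEQ_le_const) (use le in auto)
qed

text \<open>The term in the conclusion has the shape of \<open>lam_opt\<close>, so later arguments
  need no case distinction on whether a finite minimizer exists.\<close>

lemma least_minimizer_extended:
  fixes f :: "ereal \<Rightarrow> real"
  assumes cont: "continuous_on {0..} f"
  defines "is_min \<equiv> is_arg_min (\<lambda>l::real. f (ereal l)) (\<lambda>l. 0 \<le> l)"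
  shows "least_minimizer f (if \<exists>l. is_min l then ereal (LEAST l. is_min l) else \<infinity>)"
proof -
  have is_min: "is_min l \<longleftrightarrow> 0 \<le> l \<and> (\<forall>l'\<ge>0. f (ereal l) \<le> f (ereal l'))" for l
    by (auto simp: is_min_def is_arg_min_linorder)
  obtain m where m: "0 \<le> m" "\<And>l. 0 \<le> l \<Longrightarrow> f m \<le> f l"
    using continuous_attains_inf[OF _ _ cont] by (auto simp: compact_eq_closed)
  \<comment> \<open>The minimizers form a closed set, which therefore contains its infimum.\<close>
  define M where "M = {l \<in> {0..}. f l = f m}"
  have "closed M"
    unfolding M_def by (rule continuous_closed_preimage_constant[OF cont]) auto
  moreover have "m \<in> M" using m by (simp add: M_def)
  ultimately have "Inf M \<in> M" by (auto intro: closed_contains_Inf_cl)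
  then have I: "0 \<le> Inf M" "f (Inf M) = f m" by (auto simp: M_def)
  have lm: "least_minimizer f (Inf M)"
    unfolding least_minimizer_def
  proof (intro conjI allI impI)
    fix l assume l: "0 \<le> l \<and> l < Inf M"
    then have "l \<notin> M" by (meson Inf_lower not_less)
    then show "f (Inf M) < f l" using l m(2)[of l] I by (auto simp: M_def)
  qed (use I m in auto)
  show ?thesis
  proof (cases "Inf M")
    case (real b)
    have "is_min b" using lm real by (auto simp: is_min least_minimizer_def)
    moreover have "b \<le> l" if "is_min l" for l
    proof (rule ccontr)
      assume "\<not> b \<le> l"
      then have "f (ereal b) < f (ereal l)" using lm real that by (auto simp: is_min least_minimizer_def)
      moreover have "f (ereal l) \<le> f (ereal b)" using that \<open>is_min b\<close> by (auto simp: is_min)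
      ultimately show False by simp
    qed
    ultimately have "(LEAST l. is_min l) = b" by (blast intro: Least_equality)
    then show ?thesis using lm real \<open>is_min b\<close> by auto
  next
    case PInf
    have "\<not> is_min l" for l
    proof
      assume "is_min l"
      then have "f (ereal l) \<le> f \<infinity>" by (intro le_at_infinity[OF cont]) (auto simp: is_min)
      moreover have "f \<infinity> < f (ereal l)"
        using lm PInf \<open>is_min l\<close> by (auto simp: is_min least_minimizer_def)
      ultimately show False by simp
    qed
    then show ?thesis using lm PInf by simp
  qed (use I in auto)
qed

text \<open>Endpoints replace increments, with \<open>\<epsilon> = l' - l\<close> and
  \<open>\<delta> = R - r\<close>. Here \<open>l'\<close> may be infinite, while
  \<open>l < l'\<close> keeps \<open>l\<close> finite.\<close>

lemma strictly_supermodularD: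
  assumes sm: "strictly_supermodular F" and "0 \<le> l" "l < l'" "r < R" "0 < r"
  shows "F l' r - F l r < F l' R - F l R"
proof -
  obtain x where x: "l = ereal x" using \<open>0 \<le> l\<close> \<open>l < l'\<close> by (cases l) auto
  have e: "ereal x + (l' - ereal x) = l'" by (cases l') auto
  have "0 < l' - ereal x" using \<open>l < l'\<close> x by (cases l') auto
  then have "(F (ereal x + (l' - ereal x)) R - F (ereal x) R)
      - (F (ereal x + (l' - ereal x)) (R - (R - r)) - F (ereal x) (R - (R - r))) > 0"
    by (intro sm[unfolded strictly_supermodular_def, rule_format]) (use assms x in auto)
  then show ?thesis unfolding e x by simp
qed

text \<open>A minimizer at radius \<open>R\<close> strictly beats everything below it at smaller radii.\<close>

lemma supermodular_minimizer_le:
  assumes sm: "strictly_supermodular F" and rR: "0 < r" "r < R"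
    and b: "\<And>l. 0 \<le> l \<Longrightarrow> F b R \<le> F l R" "0 \<le> b"
    and m: "least_minimizer (\<lambda>l. F l r) m"
  shows "b \<le> m"
proof (rule ccontr)
  assume "\<not> b \<le> m"
  \<comment> \<open>Passing from \<open>m\<close> up to \<open>b\<close> cannot lower
    \<open>F\<close> at \<open>r\<close> nor raise it at \<open>R\<close>, yet supermodularity makes
    the increment at \<open>R\<close> the larger one.\<close>
  then have "F b r - F m r < F b R - F m R"
    using sm rR m by (intro strictly_supermodularD) (auto simp: least_minimizer_def)
  moreover have "F b R \<le> F m R" "F m r \<le> F b r"
    using b m by (auto simp: least_minimizer_def)
  ultimately show False by simp
qed

lemma supermodular_well_separated:
  assumes sm: "strictly_supermodular F" and cont: "continuous_on {0..} (\<lambda>l. F l R)"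
    and h: "\<And>r. 0 < r \<Longrightarrow> least_minimizer (\<lambda>l. F l r) (h r)"
    and R: "0 < R" and hc: "isCont h R" and hR: "h R = ereal b" and \<epsilon>: "0 < \<epsilon>"
  shows "(INF l\<in>{0..} - {b - \<epsilon>..b + \<epsilon>}. ereal (F (ereal l) R)) - ereal (F (ereal b) R) > 0"
proof -
  \<comment> \<open>Removing an open interval leaves a compact set; including infinity catches
    minimizing sequences that escape.\<close>
  define K where "K = {0..} - {ereal (b - \<epsilon>)<..<ereal (b + \<epsilon>)}"
  have "compact K" unfolding K_def compact_eq_closed by (intro closed_Diff) auto
  moreover have "\<infinity> \<in> K" by (simp add: K_def)
  moreover have "continuous_on K (\<lambda>l. F l R)"
    using cont by (rule continuous_on_subset) (auto simp: K_def)
  ultimately obtain c where c: "c \<in> K" "\<And>l. l \<in> K \<Longrightarrow> F c R \<le> F l R"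
    using continuous_attains_inf[of K "\<lambda>l. F l R"] by blast
  have lm: "least_minimizer (\<lambda>l. F l R) (ereal b)" using h[OF R] hR by simp
  have c0: "0 \<le> c" "c \<noteq> ereal b" using c(1) \<epsilon> by (auto simp: K_def)
  have "F (ereal b) R < F c R"
  proof (rule ccontr)
    assume not_less: "\<not> ?thesis"
    then have cmin: "F c R \<le> F l R" if "0 \<le> l" for l
      using lm that by (force simp: least_minimizer_def)
    have "ereal b < c"
      using lm c0 not_less cmin[of "ereal b"] by (cases "c < ereal b") (auto simp: least_minimizer_def)
    \<comment> \<open>Just left of \<open>R\<close>, continuity keeps \<open>h r\<close> below
      \<open>c\<close>, while minimality of \<open>c\<close> at \<open>R\<close> forces
      \<open>c \<le> h r\<close>.\<close>
    then have "\<forall>\<^sub>F r in at_left R. h r < c"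
      using hc hR by (intro order_tendstoD(2)[where y = "h R"])
        (auto simp: isCont_def intro: tendsto_mono[OF at_le])
    moreover have "\<forall>\<^sub>F r in at_left R. 0 < r \<and> r < R"
      using R by (auto simp: eventually_at_left)
    ultimately have "\<forall>\<^sub>F r in at_left R. False"
    proof eventually_elim
      case (elim r)
      then have "c \<le> h r"
        using supermodular_minimizer_le[OF sm _ _ cmin c0(1) h] by blast
      then show False using elim by simp
    qed
    then show False by simp
  qed
  moreover have "ereal (F c R) \<le> (INF l\<in>{0..} - {b - \<epsilon>..b + \<epsilon>}. ereal (F (ereal l) R))"
    by (rule INF_greatest) (auto simp: K_def intro!: c(2))
  ultimately show ?thesis
    by (metis ereal_diff_gr0 less_ereal.simps(1) less_le_trans)
qed

section \<open>Quadratic penalties\<close>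

lemma tendsto_at_infinity_ereal:
  fixes G :: "ereal \<Rightarrow> 'a::real_normed_vector"
  assumes "\<And>l. 0 < l \<Longrightarrow> norm (G (ereal l) - G \<infinity>) \<le> K / l"
  shows "(G \<longlongrightarrow> G \<infinity>) (at \<infinity> within S)"
proof (rule tendstoI)
  fix e :: real assume "0 < e"
  \<comment> \<open>The bound \<open>K / e\<close> yields the required accuracy; the 1 ensures
    \<open>l\<close> is positive whatever the sign of \<open>K\<close>.\<close>
  have "\<forall>\<^sub>F l in at \<infinity> within S. ereal (max 1 (K / e)) < l"
    by (rule order_tendstoD(1)[OF tendsto_ident_at]) (rule ereal_less_PInfty, simp add: max_def)
  then show "\<forall>\<^sub>F l in at \<infinity> within S. dist (G l) (G \<infinity>) < e"
  proof eventually_elim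
    case (elim l)
    show ?case
    proof (cases l)
      case (real x)
      then have "0 < x" "K / e < x" using elim by auto
      then have "K / x < e" using \<open>0 < e\<close> by (simp add: field_simps)
      then show ?thesis using assms[OF \<open>0 < x\<close>] real by (simp add: dist_norm)
    qed (use elim \<open>0 < e\<close> in auto)
  qed
qed

section \<open>Positive definite matrices and the first-order condition\<close>

lemma matrix_inv_cancel:
  fixes A :: "real ^ 'k ^ 'k"
  assumes "invertible A"
  shows "A *v (matrix_inv A *v x) = x" "matrix_inv A *v (A *v x) = x"
proof -
  have "A ** matrix_inv A = mat 1 \<and> matrix_inv A ** A = mat 1"
    using assms unfolding invertible_def matrix_inv_def by (rule someI_ex)
  then show "A *v (matrix_inv A *v x) = x" "matrix_inv A *v (A *v x) = x"
    by (simp_all add: matrix_vector_mul_assoc)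
qed

lemma pos_def_inner_commute: "pos_def M \<Longrightarrow> (M *v x) \<bullet> y = x \<bullet> (M *v y)"
  by (metis dot_lmul_matrix pos_def_def vector_transpose_matrix)

lemma pos_def_inner_nonneg: "pos_def M \<Longrightarrow> 0 \<le> x \<bullet> (M *v x)"
  unfolding pos_def_def by (cases "x = 0") (auto simp: less_imp_le)

lemma pos_def_mult_eq_0: "pos_def M \<Longrightarrow> M *v x = 0 \<longleftrightarrow> x = 0"
  unfolding pos_def_def by (metis inner_zero_right less_irrefl matrix_vector_mult_0_right)

lemma pos_def_invertible: "pos_def M \<Longrightarrow> invertible M"
  by (simp add: invertible_left_inverse matrix_left_invertible_ker pos_def_mult_eq_0)

lemma pos_def_matrix_inv:
  assumes "pos_def M" shows "pos_def (matrix_inv M)"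
proof -
  note inv = matrix_inv_cancel[OF pos_def_invertible[OF assms]]
  have "(matrix_inv M *v x) \<bullet> y = x \<bullet> (matrix_inv M *v y)" for x y
    by (metis assms inv(1) pos_def_inner_commute)
  then have "transpose (matrix_inv M) = matrix_inv M"
    by (metis adjoint_matrix adjoint_unique matrix_of_matrix_vector_mul)
  moreover have "0 < x \<bullet> (matrix_inv M *v x)" if "x \<noteq> 0" for x
  proof -
    have "matrix_inv M *v x \<noteq> 0" using inv(1)[of x] that by auto
    \<comment> \<open>The quadratic form of the inverse at \<open>x\<close> is that of
      \<open>M\<close> at \<open>matrix_inv M *v x\<close>.\<close>
    then have "0 < (matrix_inv M *v x) \<bullet> (M *v (matrix_inv M *v x))"
      using assms by (simp add: pos_def_def)
    then show ?thesis by (simp add: inv inner_commute)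
  qed
  ultimately show ?thesis by (simp add: pos_def_def)
qed

lemma pos_def_id_plus:
  assumes "pos_def B" "0 \<le> l" shows "pos_def (mat 1 + l *\<^sub>R B)"
proof -
  have "transpose (mat 1 + l *\<^sub>R B) = mat 1 + l *\<^sub>R B"
    using assms(1) by (simp add: pos_def_def vec_eq_iff transpose_def mat_def)
  moreover have "0 < x \<bullet> ((mat 1 + l *\<^sub>R B) *v x)" if "x \<noteq> 0" for x
    using that assms pos_def_inner_nonneg[of B x]
    by (simp add: matrix_vector_mult_add_rdistrib scaleR_matrix_vector_assoc[symmetric]
        inner_add_right add_pos_nonneg)
  ultimately show ?thesis by (simp add: pos_def_def)
qed

text \<open>
  \<open>shrink B l\<close> is the paper's \<open>C\<^sub>\<lambda>\<close> in terms of \<open>B = A\<inverse>\<close>, rewritten as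
  \<open>- \<lambda> (I + \<lambda> B)\<inverse> B\<close> so that \<open>\<lambda> = 0\<close> needs no convention.
\<close>

definition shrink :: "real ^ 'k ^ 'k \<Rightarrow> ereal \<Rightarrow> real ^ 'k ^ 'k" where
  "shrink B l = (if l = \<infinity> then - mat 1
     else (- real_of_ereal l) *\<^sub>R (matrix_inv (mat 1 + real_of_ereal l *\<^sub>R B) ** B))"

lemma shrink_infinity: "shrink B \<infinity> *v x = - x"
  by (simp add: shrink_def)
     (metis diff_0 matrix_vector_mul_lid matrix_vector_mult_0 matrix_vector_mult_diff_rdistrib)

lemma shrink_first_order:
  assumes "pos_def B" "0 \<le> l"
  shows "shrink B (ereal l) *v x = - l *\<^sub>R (B *v (x + shrink B (ereal l) *v x))"
proof -
  let ?M = "mat 1 + l *\<^sub>R B"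
  let ?g = "shrink B (ereal l) *v x"
  have "?g = - l *\<^sub>R (matrix_inv ?M *v (B *v x))"
    by (simp add: shrink_def scaleR_matrix_vector_assoc[symmetric] matrix_vector_mul_assoc
        del: scaleR_minus_left)
  then have "?M *v ?g = - l *\<^sub>R (B *v x)"
    using matrix_inv_cancel(1)[OF pos_def_invertible[OF pos_def_id_plus[OF assms]]]
    by (simp only: matrix_vector_mult_scaleR)
  then have "?g + l *\<^sub>R (B *v ?g) = - l *\<^sub>R (B *v x)"
    by (simp add: matrix_vector_mult_add_rdistrib scaleR_matrix_vector_assoc[symmetric])
  then show ?thesis
    by (simp add: matrix_vector_right_distrib scaleR_add_right eq_diff_eq)
qed

section \<open>The penalized step as a linear map, and its norm\<close>

locale quadratic_penalty =
  fixes B :: "real ^ 'k ^ 'k" and \<pi> :: "real ^ 'k \<Rightarrow> real"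
  assumes pd: "pos_def B" and \<pi>_eq: "\<And>x. \<pi> x = 1/2 * (x \<bullet> (B *v x))"
begin

lemma penalty_nonneg: "0 \<le> \<pi> x"
  using pos_def_inner_nonneg[OF pd] by (simp add: \<pi>_eq)

lemma penalty_zero: "\<pi> x = 0 \<longleftrightarrow> x = 0"
  using pd by (auto simp: \<pi>_eq pos_def_def)

text \<open>Expanding the objective around \<open>g0\<close>, the first-order condition cancels the
  terms linear in \<open>d = g - g0\<close>. What remains is
  \<open>1/2 * (norm d)\<^sup>2 + l * \<pi> d\<close>, which is positive.\<close>

lemma shrink_minimizes:
  assumes "0 \<le> l" and "g \<noteq> shrink B (ereal l) *v x"
  defines "g0 \<equiv> shrink B (ereal l) *v x"
  shows "1/2 * (norm g0)\<^sup>2 + l * \<pi> (x + g0) < 1/2 * (norm g)\<^sup>2 + l * \<pi> (x + g)"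
proof -
  define d where "d = g - g0"
  have foc: "g0 \<bullet> d = - l * ((B *v (x + g0)) \<bullet> d)"
    using arg_cong[OF shrink_first_order[OF pd \<open>0 \<le> l\<close>, of x], of "\<lambda>v. v \<bullet> d"]
    unfolding g0_def by simp
  have sym: "d \<bullet> (B *v (x + g0)) = (B *v (x + g0)) \<bullet> d"
    "(x + g0) \<bullet> (B *v d) = (B *v (x + g0)) \<bullet> d"
    by (simp_all add: inner_commute pos_def_inner_commute[OF pd])
  have "\<pi> (x + g) = \<pi> ((x + g0) + d)" by (simp add: d_def)
  also have "\<dots> = \<pi> (x + g0) + (B *v (x + g0)) \<bullet> d + \<pi> d"
    unfolding \<pi>_eq matrix_vector_right_distrib[of B "x + g0" d] inner_add_left[of "x + g0" d]
      inner_add_right[of _ "B *v (x + g0)"] sym by simp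
  finally have \<pi>g: "\<pi> (x + g) = \<pi> (x + g0) + (B *v (x + g0)) \<bullet> d + \<pi> d" .
  have "(norm g)\<^sup>2 = (norm (g0 + d))\<^sup>2" by (simp add: d_def)
  also have "\<dots> = (norm g0)\<^sup>2 + 2 * (g0 \<bullet> d) + (norm d)\<^sup>2"
    by (simp add: power2_norm_eq_inner inner_add_left inner_add_right inner_commute)
  finally have "1/2 * (norm g)\<^sup>2 + l * \<pi> (x + g)
      = (1/2 * (norm g0)\<^sup>2 + l * \<pi> (x + g0)) + (1/2 * (norm d)\<^sup>2 + l * \<pi> d)"
    using foc unfolding \<pi>g by (simp add: algebra_simps)
  moreover have "0 < (norm d)\<^sup>2"
    using assms(2) by (simp add: d_def g0_def)
  moreover have "0 \<le> l * \<pi> d" using \<open>0 \<le> l\<close> penalty_nonneg by simp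
  ultimately show ?thesis by linarith
qed

lemma pen_step_eq:
  assumes "0 \<le> l"
  shows "pen_step \<pi> l = (\<lambda>x. shrink B l *v x)"
proof
  fix x
  let ?f = "\<lambda>g. ereal (1/2 * (norm g)\<^sup>2) + l * ereal (\<pi> (x + g))"
  have strict: "?f (shrink B l *v x) < ?f g" if "g \<noteq> shrink B l *v x" for g
  proof (cases l)
    case (real r)
    then show ?thesis using assms that shrink_minimizes[of r g x] by simp
  next
    \<comment> \<open>Every step other than \<open>- x\<close> has infinite objective, while
      \<open>- x\<close> has a finite one because \<open>\<infinity> * 0 = 0\<close>.\<close>
    case PInf
    then have "x + g \<noteq> 0" using that by (simp add: shrink_infinity eq_neg_iff_add_eq_0 add.commute)
    then have "0 < \<pi> (x + g)" using penalty_nonneg penalty_zero by (simp add: less_le)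
    then show ?thesis using PInf penalty_zero[of 0] by (simp add: shrink_infinity)
  qed (use assms in auto)
  \<comment> \<open>Uniqueness of the minimizer determines the choice made by
    \<open>ARG_MIN\<close>.\<close>
  then have "is_arg_min ?f (\<lambda>g. True) g \<longleftrightarrow> g = shrink B l *v x" for g
    unfolding is_arg_min_linorder by (metis less_imp_le not_le order_refl)
  then show "pen_step \<pi> l x = shrink B l *v x" by (simp add: pen_step_def arg_min_def)
qed

lemma SURE_eq:
  assumes "0 \<le> l"
  shows "SURE \<pi> \<Sigma> l x
    = 1/2 * (trace \<Sigma> + (norm (shrink B l *v x))\<^sup>2 + 2 * trace (shrink B l ** \<Sigma>))"
proof -
  have "frechet_derivative (\<lambda>x. shrink B l *v x) (at x) = (\<lambda>x. shrink B l *v x)"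
    by (intro frechet_derivative_at[symmetric] linear_imp_has_derivative matrix_vector_mul_linear)
  then show ?thesis by (simp add: SURE_def pen_step_eq[OF assms] jacobian_def)
qed

text \<open>The competitor \<open>- x\<close> has zero penalty, so the optimal step cannot be
  longer.\<close>

lemma norm_shrink_le:
  assumes "0 \<le> l" shows "norm (shrink B l *v x) \<le> norm x"
proof (cases l)
  case (real r)
  then have "0 \<le> r" using assms by simp
  show ?thesis
  proof (cases "shrink B l *v x = - x")
    case False
    then have "1/2 * (norm (shrink B l *v x))\<^sup>2 + r * \<pi> (x + shrink B l *v x) < 1/2 * (norm x)\<^sup>2"
      using shrink_minimizes[OF \<open>0 \<le> r\<close>, of "- x" x] real penalty_zero[of 0] by auto
    moreover have "0 \<le> r * \<pi> (x + shrink B l *v x)" using \<open>0 \<le> r\<close> penalty_nonneg by simp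
    ultimately show ?thesis by - (rule power2_le_imp_le[OF _ norm_ge_zero, of _ x], linarith)
  qed simp
qed (use assms in \<open>auto simp: shrink_infinity\<close>)

text \<open>Comparing the two strict optimality inequalities crosswise orders the norms.\<close>

lemma norm_shrink_strict_mono:
  assumes "0 \<le> l" "l < l'" "x \<noteq> 0"
  shows "norm (shrink B l *v x) < norm (shrink B l' *v x)"
proof -
  obtain r where r: "l = ereal r" "0 \<le> r" using assms by (cases l) auto
  define g where "g = shrink B l *v x"
  define g' where "g' = shrink B l' *v x"
  have foc: "g = - r *\<^sub>R (B *v (x + g))"
    using shrink_first_order[OF pd r(2), of x] by (simp add: g_def r)
  have ne: "x + g \<noteq> 0" using foc \<open>x \<noteq> 0\<close> by (metis add.right_neutral matrix_vector_mult_0_right scaleR_zero_right)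
  have opt: "1/2 * (norm g)\<^sup>2 + r * \<pi> (x + g) < 1/2 * (norm g')\<^sup>2 + r * \<pi> (x + g')" if "g' \<noteq> g"
    using shrink_minimizes[OF r(2), of g' x] that by (simp add: g_def r)
  \<comment> \<open>If the heavier weight gives a different step with no larger penalty, optimality
    of \<open>g\<close> at weight \<open>r\<close> forces \<open>g'\<close> to be longer.\<close>
  have "g' \<noteq> g \<and> \<pi> (x + g') \<le> \<pi> (x + g)"
  proof (cases l')
    case (real r')
    then have "r < r'" using assms(2) r by simp
    have foc': "g' = - r' *\<^sub>R (B *v (x + g'))"
      using shrink_first_order[OF pd, of r' x] \<open>r < r'\<close> r by (simp add: g'_def real)
    have "g' \<noteq> g"
    proof
      assume "g' = g"
      then have "r *\<^sub>R (B *v (x + g)) = r' *\<^sub>R (B *v (x + g))"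
        using foc foc' by (metis neg_equal_iff_equal scaleR_minus_left)
      then show False using ne \<open>r < r'\<close> by (simp add: pos_def_mult_eq_0[OF pd])
    qed
    moreover have "1/2 * (norm g')\<^sup>2 + r' * \<pi> (x + g') < 1/2 * (norm g)\<^sup>2 + r' * \<pi> (x + g)"
      using shrink_minimizes[of r' g x] \<open>g' \<noteq> g\<close> \<open>r < r'\<close> r by (simp add: g'_def real)
    \<comment> \<open>Adding the two optimality inequalities cancels the norms.\<close>
    ultimately have "(r' - r) * \<pi> (x + g') < (r' - r) * \<pi> (x + g)"
      using opt by (simp add: algebra_simps)
    then show ?thesis using \<open>r < r'\<close> \<open>g' \<noteq> g\<close> by simp
  next
    case PInf
    then have "g' = - x" by (simp add: g'_def shrink_infinity)
    then show ?thesis using ne penalty_nonneg penalty_zero[of 0] by auto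
  qed (use assms in auto)
  then have "(norm g)\<^sup>2 < (norm g')\<^sup>2"
    using opt mult_left_mono[OF _ r(2), of "\<pi> (x + g')" "\<pi> (x + g)"] by linarith
  then show ?thesis by (auto intro: power2_less_imp_less simp: g_def g'_def)
qed

section \<open>Continuity in the penalty parameter\<close>

lemma shrink_lipschitz:
  assumes "0 \<le> r" "0 \<le> s"
  shows "norm (shrink B (ereal s) *v x - shrink B (ereal r) *v x)
    \<le> \<bar>s - r\<bar> * norm (B *v (x + shrink B (ereal r) *v x))"
proof -
  define g where "g = shrink B (ereal r) *v x"
  define h where "h = shrink B (ereal s) *v x"
  have "g = - r *\<^sub>R (B *v (x + g))" "h = - s *\<^sub>R (B *v (x + h))"
    using shrink_first_order[OF pd] assms by (simp_all add: g_def h_def)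
  then have "h - g = - s *\<^sub>R (B *v (x + h)) + r *\<^sub>R (B *v (x + g))"
    by (metis diff_minus_eq_add scaleR_minus_left)
  also have "\<dots> = (r - s) *\<^sub>R (B *v (x + g)) - s *\<^sub>R (B *v (h - g))"
    by (simp add: matrix_vector_right_distrib matrix_vector_mult_diff_distrib algebra_simps)
  \<comment> \<open>After taking the inner product with \<open>h - g\<close>, the last term is
    nonpositive by positivity of \<open>B\<close>. Cauchy-Schwarz and cancelling one factor
    \<open>norm (h - g)\<close> then finish.\<close>
  finally have "(h - g) \<bullet> (h - g)
      = (r - s) * ((B *v (x + g)) \<bullet> (h - g)) - s * ((B *v (h - g)) \<bullet> (h - g))"
    by (metis inner_diff_left inner_scaleR_left)
  also have "\<dots> \<le> (r - s) * ((B *v (x + g)) \<bullet> (h - g))"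
    using assms pos_def_inner_nonneg[OF pd] by (simp add: inner_commute)
  also have "\<dots> \<le> \<bar>(r - s) * ((B *v (x + g)) \<bullet> (h - g))\<bar>"
    by (rule abs_ge_self)
  also have "\<dots> \<le> \<bar>r - s\<bar> * (norm (B *v (x + g)) * norm (h - g))"
    using mult_left_mono[OF Cauchy_Schwarz_ineq2[of "B *v (x + g)" "h - g"] abs_ge_zero[of "r - s"]]
    by (simp only: abs_mult)
  finally have "norm (h - g) * norm (h - g) \<le> (\<bar>s - r\<bar> * norm (B *v (x + g))) * norm (h - g)"
    unfolding dot_square_norm power2_eq_square abs_minus_commute[of r s] mult.assoc .
  then show ?thesis
    unfolding g_def[symmetric] h_def[symmetric] by (cases "h = g") auto
qed

text \<open>Applying the inverse of \<open>B\<close> to the first-order condition expresses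
  \<open>r *\<^sub>R (x + g)\<close> through \<open>g\<close>, whose norm is at most that of
  \<open>x\<close>; and \<open>x + g\<close> is exactly the deviation from the limit step
  \<open>- x\<close>.\<close>

lemma shrink_at_infinity:
  "\<exists>K. \<forall>r>0. norm (shrink B (ereal r) *v x - shrink B \<infinity> *v x) \<le> K / r"
proof -
  have inv: "matrix_inv B *v (B *v y) = y" for y
    by (rule matrix_inv_cancel[OF pos_def_invertible[OF pd]])
  obtain K where K: "\<And>y. norm (matrix_inv B *v y) \<le> norm y * K" "0 \<le> K"
    using bounded_linear.nonneg_bounded[OF matrix_vector_mul_bounded_linear[of "matrix_inv B"]] by blast
  show ?thesis
  proof (intro exI allI impI)
    fix r :: real assume "0 < r"
    define g where "g = shrink B (ereal r) *v x"
    have "g = - r *\<^sub>R (B *v (x + g))"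
      using shrink_first_order[OF pd, of r x] \<open>0 < r\<close> by (simp add: g_def)
    then have "matrix_inv B *v g = - r *\<^sub>R (x + g)"
      by (metis inv matrix_vector_mult_scaleR)
    then have "r * norm (x + g) = norm (matrix_inv B *v g)" using \<open>0 < r\<close> by simp
    also have "\<dots> \<le> norm x * K"
      using K(1)[of g] mult_right_mono[OF norm_shrink_le[of "ereal r" x] K(2)] \<open>0 < r\<close>
      by (simp add: g_def)
    finally show "norm (shrink B (ereal r) *v x - shrink B \<infinity> *v x) \<le> norm x * K / r"
      using \<open>0 < r\<close> by (simp add: shrink_infinity g_def field_simps)
  qed
qed

lemma continuous_on_shrink: "continuous_on {0..} (\<lambda>l. shrink B l *v x)"
  unfolding continuous_on
proof
  fix l :: ereal assume "l \<in> {0..}"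
  show "((\<lambda>l. shrink B l *v x) \<longlongrightarrow> shrink B l *v x) (at l within {0..})"
  proof (cases l)
    case (real r)
    then have "0 \<le> r" using \<open>l \<in> {0..}\<close> by simp
    have lim: "((\<lambda>s. \<bar>real_of_ereal s - r\<bar> * norm (B *v (x + shrink B (ereal r) *v x))) \<longlongrightarrow> 0)
        (at l within {0..})"
      using real by (auto intro!: tendsto_eq_intros lim_real_of_ereal)
    have "\<forall>\<^sub>F s in at l within {0..}. s < \<infinity> \<and> 0 \<le> s"
      unfolding eventually_conj_iff using real
      by (intro conjI order_tendstoD(2)[OF tendsto_ident_at])
        (auto simp: eventually_at_filter)
    then have "\<forall>\<^sub>F s in at l within {0..}. norm (shrink B s *v x - shrink B l *v x)
        \<le> \<bar>real_of_ereal s - r\<bar> * norm (B *v (x + shrink B (ereal r) *v x))"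
    proof eventually_elim
      case (elim s)
      then show ?case using shrink_lipschitz[OF \<open>0 \<le> r\<close>] real by (cases s) auto
    qed
    then have "((\<lambda>s. shrink B s *v x - shrink B l *v x) \<longlongrightarrow> 0) (at l within {0..})"
      by (rule Lim_null_comparison[OF _ lim])
    then show ?thesis by (simp add: LIM_zero_iff)
  next
    case PInf
    obtain K where "\<And>r. 0 < r \<Longrightarrow> norm (shrink B (ereal r) *v x - shrink B \<infinity> *v x) \<le> K / r"
      using shrink_at_infinity by blast
    then show ?thesis unfolding PInf by (rule tendsto_at_infinity_ereal)
  qed (use \<open>l \<in> {0..}\<close> in auto)
qed

lemma continuous_on_SURE: "continuous_on {0..} (\<lambda>l. SURE \<pi> \<Sigma> l x)"
proof -
  have comp: "continuous_on {0..} (\<lambda>l. shrink B l $ i $ j)" for i j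
  proof -
    \<comment> \<open>Matrix entries are coordinates of images of basis vectors, so continuity at
      each vector also covers the trace.\<close>
    have "shrink B l $ i $ j = (shrink B l *v axis j 1) $ i" for l
      by (simp add: matrix_vector_mult_basis column_def)
    then show ?thesis using continuous_on_shrink by (simp add: continuous_on_component)
  qed
  then have "continuous_on {0..} (\<lambda>l. 1/2 * (trace \<Sigma> + (norm (shrink B l *v x))\<^sup>2
      + 2 * trace (shrink B l ** \<Sigma>)))"
    unfolding trace_def matrix_matrix_mult_def
    by (simp, intro comp continuous_on_shrink continuous_on_add continuous_on_mult continuous_on_sum
        continuous_on_power continuous_on_norm continuous_on_const continuous_on_divide) auto
  then show ?thesis by (rule continuous_on_eq) (simp add: SURE_eq)
qed

section \<open>Supermodularity, uniform convergence and monotone minimizers\<close>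

lemma strictly_supermodular_SURE:
  assumes "norm \<nu> = 1"
  shows "strictly_supermodular (\<lambda>l R. SURE_polar \<pi> \<Sigma> l R \<nu>)"
  unfolding strictly_supermodular_def
proof (intro allI impI)
  fix l :: real and \<epsilon> :: ereal and R \<delta> :: real
  assume H: "0 \<le> l \<and> 0 < \<epsilon> \<and> 0 < \<delta> \<and> \<delta> < R"
  define u where "u = ereal l + \<epsilon>"
  have u: "ereal l < u" "0 \<le> u" using H by (cases \<epsilon>; simp add: u_def)+
  let ?N = "\<lambda>l. (norm (shrink B l *v \<nu>))\<^sup>2"
  have S: "SURE_polar \<pi> \<Sigma> l R \<nu> = 1/2 * (trace \<Sigma> + R\<^sup>2 * ?N l + 2 * trace (shrink B l ** \<Sigma>))"
    if "0 \<le> l" for l R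
    using that by (simp add: SURE_polar_def SURE_eq matrix_vector_mult_scaleR power_mult_distrib)
  have "\<nu> \<noteq> 0" using assms by auto
  then have "?N (ereal l) < ?N u"
    using norm_shrink_strict_mono[of "ereal l" u \<nu>] u H by (intro power_strict_mono) auto
  moreover have "(R - \<delta>)\<^sup>2 < R\<^sup>2" using H by (intro power_strict_mono) auto
  \<comment> \<open>This product is twice the double difference: the trace terms do not depend on
    the radius.\<close>
  ultimately have "0 < (R\<^sup>2 - (R - \<delta>)\<^sup>2) * (?N u - ?N (ereal l))" by simp
  then show "0 < SURE_polar \<pi> \<Sigma> (ereal l + \<epsilon>) R \<nu> - SURE_polar \<pi> \<Sigma> (ereal l) R \<nu>
      - (SURE_polar \<pi> \<Sigma> (ereal l + \<epsilon>) (R - \<delta>) \<nu> - SURE_polar \<pi> \<Sigma> (ereal l) (R - \<delta>) \<nu>)"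
    unfolding u_def[symmetric] using H u by (simp add: S algebra_simps)
qed

lemma SURE_sup_diff_tendsto_0:
  "((\<lambda>y. SUP l\<in>Lam. ereal \<bar>SURE \<pi> \<Sigma> l y - SURE \<pi> \<Sigma> l x\<bar>) \<longlongrightarrow> 0) (at x)"
proof (rule tendsto_sandwich)
  let ?b = "\<lambda>y. 1/2 * (norm (y - x) * (norm y + norm x))"
  have bound: "\<bar>SURE \<pi> \<Sigma> l y - SURE \<pi> \<Sigma> l x\<bar> \<le> ?b y" if "l \<in> Lam" for l y
  proof -
    have l: "0 \<le> l" using that by (simp add: Lam_def)
    let ?a = "norm (shrink B l *v y)" and ?c = "norm (shrink B l *v x)"
    have "\<bar>?a - ?c\<bar> \<le> norm (shrink B l *v (y - x))"
      by (simp add: norm_triangle_ineq3 matrix_vector_mult_diff_distrib)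
    also have "\<dots> \<le> norm (y - x)" by (rule norm_shrink_le[OF l])
    finally have "\<bar>?a - ?c\<bar> * \<bar>?a + ?c\<bar> \<le> norm (y - x) * (norm y + norm x)"
      using norm_shrink_le[OF l, of x] norm_shrink_le[OF l, of y] by (intro mult_mono) auto
    \<comment> \<open>The trace terms are free of the data point and cancel, leaving a difference of
      squares.\<close>
    moreover have "SURE \<pi> \<Sigma> l y - SURE \<pi> \<Sigma> l x = 1/2 * ((?a - ?c) * (?a + ?c))"
      using l by (simp add: SURE_eq power2_eq_square algebra_simps)
    ultimately show ?thesis by (simp only: abs_mult)
  qed
  show "\<forall>\<^sub>F y in at x. (SUP l\<in>Lam. ereal \<bar>SURE \<pi> \<Sigma> l y - SURE \<pi> \<Sigma> l x\<bar>) \<le> ereal (?b y)"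
    by (intro always_eventually allI SUP_least) (use bound in auto)
  \<comment> \<open>The member at parameter 0 keeps the supremum nonnegative.\<close>
  show "\<forall>\<^sub>F y in at x. 0 \<le> (SUP l\<in>Lam. ereal \<bar>SURE \<pi> \<Sigma> l y - SURE \<pi> \<Sigma> l x\<bar>)"
    by (intro always_eventually allI SUP_upper2[of 0]) (auto simp: Lam_def)
  have "(?b \<longlongrightarrow> 0) (at x)" by (auto intro!: tendsto_eq_intros)
  then show "((\<lambda>y. ereal (?b y)) \<longlongrightarrow> 0) (at x)" by (simp add: zero_ereal_def)
qed simp

lemma lam_opt_least_minimizer:
  "least_minimizer (\<lambda>l. SURE_polar \<pi> \<Sigma> l R \<nu>) (lam_opt \<pi> \<Sigma> R \<nu>)"
proof -
  have "continuous_on {0..} (\<lambda>l. SURE_polar \<pi> \<Sigma> l R \<nu>)"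
    by (simp add: SURE_polar_def continuous_on_SURE)
  from least_minimizer_extended[OF this] show ?thesis by (simp only: lam_opt_def Let_def)
qed

lemma antimono_lam_opt:
  assumes "norm \<nu> = 1"
  shows "antimono_on {0<..} (\<lambda>R. lam_opt \<pi> \<Sigma> R \<nu>)"
proof (rule monotone_onI)
  fix r R :: real assume "r \<in> {0<..}" "R \<in> {0<..}" "r \<le> R"
  \<comment> \<open>Equal radii are split off because the comparison of minimizers requires
    \<open>r < R\<close>.\<close>
  then show "lam_opt \<pi> \<Sigma> R \<nu> \<le> lam_opt \<pi> \<Sigma> r \<nu>"
    using supermodular_minimizer_le[OF strictly_supermodular_SURE[OF assms, of \<Sigma>] _ _ _ _
        lam_opt_least_minimizer, of r R "lam_opt \<pi> \<Sigma> R \<nu>"]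
      lam_opt_least_minimizer[of \<Sigma> R \<nu>]
    by (cases "r = R") (auto simp: least_minimizer_def)
qed

end

theorem lemma6:
  fixes A \<Sigma> :: "real ^ 'k ^ 'k"
    and \<pi> :: "real ^ 'k \<Rightarrow> real"
  assumes "pos_def A" and "pos_def \<Sigma>"
    and "\<And>\<theta>. \<pi> \<theta> = 1/2 * (\<theta> \<bullet> (matrix_inv A *v \<theta>))"
  shows "(\<forall>\<theta>. ((\<lambda>\<theta>'. SUP l\<in>Lam. ereal \<bar>SURE \<pi> \<Sigma> l \<theta>' - SURE \<pi> \<Sigma> l \<theta>\<bar>) \<longlongrightarrow> 0) (at \<theta>))
    \<and> (\<forall>\<nu>. norm \<nu> = 1 \<longrightarrow>
          strictly_supermodular (\<lambda>l R. SURE_polar \<pi> \<Sigma> l R \<nu>)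
        \<and> antimono_on {0<..} (\<lambda>R. lam_opt \<pi> \<Sigma> R \<nu>)
        \<and> countable {R. 0 < R \<and> \<not> isCont (\<lambda>r. lam_opt \<pi> \<Sigma> r \<nu>) R})
    \<and> (\<forall>\<nu> R (lbar::real) (\<epsilon>::real).
          norm \<nu> = 1 \<and> 0 < R \<and> isCont (\<lambda>r. lam_opt \<pi> \<Sigma> r \<nu>) R
          \<and> lam_opt \<pi> \<Sigma> R \<nu> = ereal lbar \<and> 0 < \<epsilon> \<longrightarrow>
          (INF l\<in>{0..} - {lbar - \<epsilon>..lbar + \<epsilon>}. ereal (SURE_polar \<pi> \<Sigma> (ereal l) R \<nu>))
            - ereal (SURE_polar \<pi> \<Sigma> (ereal lbar) R \<nu>) > 0)"
proof -
  interpret quadratic_penalty "matrix_inv A" \<pi>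
    using assms(1,3) by unfold_locales (auto intro: pos_def_matrix_inv)
  have "countable {R. 0 < R \<and> \<not> isCont (\<lambda>r. lam_opt \<pi> \<Sigma> r \<nu>) R}" if "norm \<nu> = 1" for \<nu>
    using antimono_on_ereal_countable_discont_open[OF open_greaterThan antimono_lam_opt[OF that]]
    by simp
  moreover have "(INF l\<in>{0..} - {lbar - \<epsilon>..lbar + \<epsilon>}. ereal (SURE_polar \<pi> \<Sigma> (ereal l) R \<nu>))
            - ereal (SURE_polar \<pi> \<Sigma> (ereal lbar) R \<nu>) > 0"
    if "norm \<nu> = 1" "0 < R" "isCont (\<lambda>r. lam_opt \<pi> \<Sigma> r \<nu>) R" "lam_opt \<pi> \<Sigma> R \<nu> = ereal lbar" "0 < \<epsilon>"
    for \<nu> R lbar \<epsilon>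
    by (rule supermodular_well_separated[OF strictly_supermodular_SURE[OF that(1)] _
          lam_opt_least_minimizer that(2-5)]) (simp add: SURE_polar_def continuous_on_SURE)
  ultimately show ?thesis
    using SURE_sup_diff_tendsto_0 strictly_supermodular_SURE antimono_lam_opt by auto
qed

end
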